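(* Let $n\ge 1$ and $N\ge M\ge 1$ be integers and let $A=\{\mathbf a_1,\dots,\mathbf a_N\}\subseteq\mathbb Z^n$, where each $\mathbf a_j=(a_{1j},\dots,a_{n-1,j},1)$ has last coordinate $1$. Put $\beta=\sum_{j=1}^M\mathbf a_j$ and assume that $A'=\{\mathbf a_1,\dots,\mathbf a_M\}$ is minimal for $\sigma_\beta^\circ$. If \[M=\min\{-u_n\mid u=(u_1,\dots,u_n)\in\mathcal M_\beta\text{ and }F_u(\Lambda)\neq 0\},\] then for every $u\in\mathcal M_\beta$ the series $F_u(\Lambda)$ has integral coefficients.
   Context: $\mathbb N$ denotes the nonnegative integers. $C(A)\subseteq\mathbb R^n$ is the real cone generated by $A$; $\sigma_\beta$ is the smallest closed face of $C(A)$ containing $\beta$, and $\sigma_\beta^\circ$ is its relative interior ($\sigma_\beta$ minus all its proper closed subfaces). $A'$ is minimal for $\sigma_\beta^\circ$ if for every proper subset $J\subsetneq\{1,\dots,M\}$, $\sum_{j\in J}\mathbf a_j\notin\sigma_\beta^\circ$. $\mathbb ZA$ is the subgroup of $\mathbb Z^n$ generated by $A$, $\mathcal M_\beta=(-\sigma_\beta^\circ)\cap\mathbb ZA$, and $E_\beta=\{l\in\mathbb N^N: l_j=0\text{ whenever }\mathbf a_j\notin\sigma_\beta\}$. For $u\in\mathcal M_\beta$, $F_u(\Lambda)$ is the formal Laurent series in $\Lambda_1,\dots,\Lambda_N$ \[F_u(\Lambda)=\sum_{\substack{l\in E_\beta\\ \sum_{j=1}^M(-l_j-1)\mathbf a_j+\sum_{j=M+1}^N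 l_j\mathbf a_j=u}}(-1)^{\sum_{j=1}^M l_j}\frac{\prod_{j=1}^M l_j!}{\prod_{j=M+1}^N l_j!}\,\Lambda_1^{-l_1-1}\cdots\Lambda_M^{-l_M-1}\Lambda_{M+1}^{l_{M+1}}\cdots\Lambda_N^{l_N};\] "integral coefficients" means all coefficients lie in $\mathbb Z$. *)

theory Defs
  imports "HOL-Analysis.Analysis"
begin

text \<open>
  The vectors are given as a family \<open>a 1, \<dots>, a N\<close> in \<open>int ^ 'n\<close>; only indices in
  \<open>{1..N}\<close> matter. The type \<open>'n\<close> carries no order, so the last coordinate is
  a fixed but arbitrary index \<open>n :: 'n\<close>.
\<close>

definition real_vec :: "int ^ 'n \<Rightarrow> real ^ 'n" where
  "real_vec v = (\<chi> i. real_of_int (v $ i))"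

definition coneA :: "(nat \<Rightarrow> int ^ 'n) \<Rightarrow> nat \<Rightarrow> (real ^ 'n) set" where
  "coneA a N = convex_cone hull ((\<lambda>j. real_vec (a j)) ` {1..N})"

definition latticeA :: "(nat \<Rightarrow> int ^ 'n) \<Rightarrow> nat \<Rightarrow> (int ^ 'n) set" where
  "latticeA a N = {v. \<exists>c :: nat \<Rightarrow> int. v = (\<Sum>j=1..N. c j *s a j)}"

definition beta :: "(nat \<Rightarrow> int ^ 'n) \<Rightarrow> nat \<Rightarrow> int ^ 'n" where
  "beta a M = (\<Sum>j=1..M. a j)"

definition face_sigma :: "(nat \<Rightarrow> int ^ 'n) \<Rightarrow> nat \<Rightarrow> int ^ 'n \<Rightarrow> (real ^ 'n) set" where
  "face_sigma a N b = (\<lambda>T. T face_of coneA a N \<and> closed T) hull {real_vec b}"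

definition face_sigma_int :: "(nat \<Rightarrow> int ^ 'n) \<Rightarrow> nat \<Rightarrow> int ^ 'n \<Rightarrow> (real ^ 'n) set" where
  "face_sigma_int a N b = rel_interior (face_sigma a N b)"

definition minimal_for_sigma :: "(nat \<Rightarrow> int ^ 'n) \<Rightarrow> nat \<Rightarrow> nat \<Rightarrow> bool" where
  "minimal_for_sigma a M N \<longleftrightarrow>
     (\<forall>J. J \<subset> {1..M} \<longrightarrow> real_vec (\<Sum>j\<in>J. a j) \<notin> face_sigma_int a N (beta a M))"

definition M_beta :: "(nat \<Rightarrow> int ^ 'n) \<Rightarrow> nat \<Rightarrow> nat \<Rightarrow> (int ^ 'n) set" where
  "M_beta a M N = {u \<in> latticeA a N. - real_vec u \<in> face_sigma_int a N (beta a M)}"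

text \<open>
  Elements of \<open>\<nat>\<^sup>N\<close> are functions on \<open>nat\<close> that vanish outside \<open>{1..N}\<close>, so that
  distinct functions are distinct tuples.
\<close>

definition E_beta :: "(nat \<Rightarrow> int ^ 'n) \<Rightarrow> nat \<Rightarrow> nat \<Rightarrow> (nat \<Rightarrow> nat) set" where
  "E_beta a M N = {l. (\<forall>j. j \<notin> {1..N} \<longrightarrow> l j = 0) \<and>
     (\<forall>j\<in>{1..N}. real_vec (a j) \<notin> face_sigma a N (beta a M) \<longrightarrow> l j = 0)}"

definition F_index :: "(nat \<Rightarrow> int ^ 'n) \<Rightarrow> nat \<Rightarrow> nat \<Rightarrow> int ^ 'n \<Rightarrow> (nat \<Rightarrow> nat) set" where
  "F_index a M N u = {l \<in> E_beta a M N.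
     (\<Sum>j=1..M. (- int (l j) - 1) *s a j) + (\<Sum>j=M+1..N. int (l j) *s a j) = u}"

definition F_exponent :: "nat \<Rightarrow> (nat \<Rightarrow> nat) \<Rightarrow> nat \<Rightarrow> int" where
  "F_exponent M l = (\<lambda>j. if j \<in> {1..M} then - int (l j) - 1 else int (l j))"

definition F_term :: "nat \<Rightarrow> nat \<Rightarrow> (nat \<Rightarrow> nat) \<Rightarrow> rat" where
  "F_term M N l = (-1) ^ (\<Sum>j=1..M. l j) *
     ((\<Prod>j=1..M. fact (l j)) / (\<Prod>j=M+1..N. fact (l j)))"

text \<open>
  A formal Laurent series in \<open>\<Lambda>\<^sub>1, \<dots>, \<Lambda>\<^sub>N\<close> is represented by its
  coefficient function on exponent vectors \<open>e\<close>. The sum is finite, since \<open>l\<close> is determined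
  by its exponent vector (\<open>F_exponent_inj\<close> below).
\<close>

definition F_series ::
  "(nat \<Rightarrow> int ^ 'n) \<Rightarrow> nat \<Rightarrow> nat \<Rightarrow> int ^ 'n \<Rightarrow> (nat \<Rightarrow> int) \<Rightarrow> rat" where
  "F_series a M N u e = (\<Sum>l | l \<in> F_index a M N u \<and> F_exponent M l = e. F_term M N l)"

definition integral_coeffs :: "((nat \<Rightarrow> int) \<Rightarrow> rat) \<Rightarrow> bool" where
  "integral_coeffs F \<longleftrightarrow> (\<forall>e. F e \<in> \<int>)"

lemma F_exponent_inj: "inj (F_exponent M)"
proof (rule injI)
  fix l l' assume eq: "F_exponent M l = F_exponent M l'"
  show "l = l'"
  proof
    fix j show "l j = l' j"
      using fun_cong[OF eq, of j] by (auto simp: F_exponent_def split: if_splits)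
  qed
qed

lemma F_series_exponent:
  assumes "l \<in> F_index a M N u"
  shows "F_series a M N u (F_exponent M l) = F_term M N l"
proof -
  have "{l'. l' \<in> F_index a M N u \<and> F_exponent M l' = F_exponent M l} = {l}"
    using assms injD[OF F_exponent_inj] by blast
  then show ?thesis by (simp add: F_series_def)
qed

lemma closed_coneA:
  fixes a :: "nat \<Rightarrow> int ^ 'n"
  assumes "\<And>j. j \<in> {1..N} \<Longrightarrow> a j $ n = 1"
  shows "closed (coneA a N)"
proof (cases "{1..N} = {}")
  case True
  then show ?thesis by (simp add: coneA_def)
next
  case False
  let ?V = "(\<lambda>j. real_vec (a j)) ` {1..N}"
  let ?K = "convex hull ?V"
  have K: "compact ?K"
    by (simp add: finite_imp_compact compact_convex_hull)
  have "convex {x :: real ^ 'n. x $ n = 1}"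
    using convex_hyperplane[of "axis n 1 :: real ^ 'n" 1] by (simp add: inner_axis' inner_real_def)
  then have K1: "?K \<subseteq> {x. x $ n = 1}"
    by (intro hull_minimal) (auto simp: real_vec_def assms)
  have C: "coneA a N = {c *\<^sub>R x |c x. 0 \<le> c \<and> x \<in> ?K}"
    unfolding coneA_def using False
    by (simp add: convex_cone_hull_separate_nonempty conic_hull_explicit)
  show ?thesis
    unfolding closed_sequential_limits
  proof (intro allI impI, elim conjE)
    fix x l assume x: "\<forall>k. x k \<in> coneA a N" and lim: "x \<longlonglongrightarrow> l"
    have "Bseq x" using lim by (meson Bseq_conv_Bfun convergent_def convergent_imp_Bseq)
    then obtain R where R: "\<And>k. norm (x k) \<le> R" by (auto simp: Bseq_def)
    let ?D = "(\<lambda>(c, x). c *\<^sub>R x) ` ({0..R} \<times> ?K)"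
    have "compact ?D"
      by (intro compact_continuous_image compact_Times K)
        (auto simp: case_prod_unfold intro!: continuous_intros)
    then have D: "closed ?D" by (rule compact_imp_closed)
    have "x k \<in> ?D" for k
    proof -
      obtain c y where cy: "x k = c *\<^sub>R y" "0 \<le> c" "y \<in> ?K" using x C by blast
      have "c = \<bar>x k $ n\<bar>" using cy K1 by auto
      also have "\<dots> \<le> R" using component_le_norm_cart[of "x k" n] R[of k] by linarith
      finally show ?thesis using cy by force
    qed
    then have "l \<in> ?D" using D lim unfolding closed_sequential_limits by blast
    then obtain c y where "0 \<le> c" "y \<in> ?K" "l = c *\<^sub>R y" by auto
    then show "l \<in> coneA a N" unfolding C by blast
  qed
qed

lemma face_sigma_least:
  assumes "\<And>j. j \<in> {1..N} \<Longrightarrow> a j $ n = 1" and b: "real_vec b \<in> coneA a N"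
  shows "face_sigma a N b face_of coneA a N" "closed (face_sigma a N b)"
    "real_vec b \<in> face_sigma a N b"
    "\<And>T. T face_of coneA a N \<Longrightarrow> closed T \<Longrightarrow> real_vec b \<in> T \<Longrightarrow> face_sigma a N b \<subseteq> T"
proof -
  have "convex (coneA a N)"
    by (simp add: coneA_def convex_convex_cone_hull)
  then have C: "coneA a N face_of coneA a N" "closed (coneA a N)"
    using closed_coneA[OF assms(1)] by (simp_all add: face_of_refl)
  have "face_sigma a N b = \<Inter>{T. (T face_of coneA a N \<and> closed T) \<and> real_vec b \<in> T}"
    by (simp add: face_sigma_def hull_def)
  moreover have "\<Inter>{T. (T face_of coneA a N \<and> closed T) \<and> real_vec b \<in> T} face_of coneA a N"
    using C b by (intro face_of_Inter) auto
  moreover have "closed (\<Inter>{T. (T face_of coneA a N \<and> closed T) \<and> real_vec b \<in> T})"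
    by (intro closed_Inter) auto
  ultimately show "face_sigma a N b face_of coneA a N" "closed (face_sigma a N b)"
    by simp_all
  show "real_vec b \<in> face_sigma a N b"
    by (simp add: face_sigma_def hull_inc)
  show "\<And>T. T face_of coneA a N \<Longrightarrow> closed T \<Longrightarrow> real_vec b \<in> T \<Longrightarrow> face_sigma a N b \<subseteq> T"
    unfolding face_sigma_def by (intro hull_minimal) auto
qed

lemma face_sigma_int_eq_minus_faces:
  assumes "\<And>j. j \<in> {1..N} \<Longrightarrow> a j $ n = 1" and b: "real_vec b \<in> coneA a N"
  shows "face_sigma_int a N b =
    face_sigma a N b - \<Union>{T. T face_of face_sigma a N b \<and> closed T \<and> T \<noteq> face_sigma a N b}"
    (is "_ = ?S - \<Union>?P")
proof
  have S: "convex ?S" "closed ?S"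
    using face_sigma_least[OF assms] face_of_imp_convex by blast+
  show "face_sigma_int a N b \<subseteq> ?S - \<Union>?P"
    using rel_interior_subset[of ?S] face_of_disjoint_rel_interior[of _ ?S]
    unfolding face_sigma_int_def by blast
  show "?S - \<Union>?P \<subseteq> face_sigma_int a N b"
  proof
    fix x assume x: "x \<in> ?S - \<Union>?P"
    show "x \<in> face_sigma_int a N b"
    proof (rule ccontr)
      assume "x \<notin> face_sigma_int a N b"
      then have "x \<in> closure ?S" "x \<notin> rel_interior ?S"
        using x S by (auto simp: face_sigma_int_def)
      then obtain v where v: "v \<noteq> 0" "\<And>y. y \<in> closure ?S \<Longrightarrow> v \<bullet> x \<le> v \<bullet> y"
          "\<And>y. y \<in> rel_interior ?S \<Longrightarrow> v \<bullet> x < v \<bullet> y"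
        using supporting_hyperplane_relative_frontier[OF S(1)] by blast
      let ?T = "?S \<inter> {y. v \<bullet> y = v \<bullet> x}"
      have "?T face_of ?S"
        using S v(2) by (intro face_of_Int_supporting_hyperplane_ge) (auto simp: closure_closed)
      moreover have "closed ?T" using S by (simp add: closed_Int closed_hyperplane)
      moreover have "?T \<noteq> ?S"
      proof -
        obtain y where "y \<in> rel_interior ?S" using S x rel_interior_eq_empty by blast
        moreover from this have "y \<in> ?S" using rel_interior_subset by blast
        ultimately show ?thesis using v(3)[of y] by force
      qed
      ultimately show False using x by blast
    qed
  qed
qed

end

theory Submission
  imports Defs
begin

text \<open>
  By Legendre's formula it suffices that
  \<open>\<Sum>j\<le>M. \<lfloor>l\<^sub>j/q\<rfloor> \<ge> \<Sum>j>M. \<lfloor>l\<^sub>j/q\<rfloor>\<close> for every prime power \<open>q\<close>. Write \<open>l = q m + r\<close> with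
  \<open>0 \<le> r < q\<close> and let \<open>w\<close> be the degree of the term indexed by \<open>m\<close>. Since
  \<open>-l\<^sub>j - 1 = q (-m\<^sub>j - 1) + (q - 1 - r\<^sub>j)\<close>, the vector \<open>-q w\<close> is \<open>-u\<close> plus an element of
  \<open>\<sigma>\<^sub>\<beta>\<close>, so \<open>-w\<close> is again in the relative interior and \<open>F\<^sub>w \<noteq> 0\<close>. Minimality of \<open>M\<close> then gives
  \<open>-w\<^sub>n \<ge> M\<close>, which is the desired inequality.
\<close>

section \<open>Legendre's formula and divisibility of products of factorials\<close>

lemma legendre_multiplicity_fact:
  fixes p :: nat
  assumes p: "prime p" and "n \<le> K"
  shows "multiplicity p (fact n) = (\<Sum>k=1..K. n div p ^ k)"
  using \<open>n \<le> K\<close>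
proof (induction n)
  case 0
  then show ?case by simp
next
  case (Suc n)
  have p1: "1 < p" using p prime_gt_1_nat by blast
  let ?m = "multiplicity p (Suc n)"
  \<comment> \<open>The truncation at \<open>K\<close> loses nothing: every \<open>k\<close> at
    which the quotient jumps from \<open>n\<close> to \<open>Suc n\<close> satisfies
    \<open>k \<le> ?m < p ^ ?m \<le> Suc n \<le> K\<close>.\<close>
  have "p ^ ?m \<le> Suc n" by (intro dvd_imp_le multiplicity_dvd) simp
  moreover have "?m < p ^ ?m" using p1 by (intro power_gt_expt) simp
  ultimately have m: "?m \<le> K" using Suc.prems by linarith
  have "Suc n div p ^ k = n div p ^ k + (if k \<le> ?m then 1 else 0)" for k
    unfolding div_Suc dvd_eq_mod_eq_0 [symmetric]
    using power_dvd_iff_le_multiplicity[of "Suc n" p k] p1 by simp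
  then have "(\<Sum>k=1..K. Suc n div p ^ k)
      = (\<Sum>k=1..K. n div p ^ k) + (\<Sum>k=1..K. if k \<le> ?m then 1 else 0)"
    by (simp add: sum.distrib)
  also have "(\<Sum>k=1..K. if k \<le> ?m then 1 else 0 :: nat) = card {k \<in> {1..K}. k \<le> ?m}"
    by (simp add: sum.If_cases Int_def)
  also have "{k \<in> {1..K}. k \<le> ?m} = {1..?m}" using m by auto
  also have "(\<Sum>k=1..K. n div p ^ k) = multiplicity p (fact n)"
    using Suc by simp
  also have "multiplicity p (fact n) + card {1..?m} = multiplicity p (fact (Suc n))"
    using p by (simp add: prime_elem_multiplicity_mult_distrib del: mult_Suc)
  finally show ?case by simp
qed

text \<open>Multiplicities are compared prime by prime. After swapping the two sums in Legendre's
  formula, the hypothesis applies for each \<open>k\<close> with \<open>q = p ^ k\<close>.\<close>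

lemma prod_fact_dvd_prod_fact:
  fixes l :: "'a \<Rightarrow> nat"
  assumes "finite A" "finite B"
    and le: "\<And>q. 0 < q \<Longrightarrow> (\<Sum>j\<in>B. l j div q) \<le> (\<Sum>j\<in>A. l j div q)"
  shows "(\<Prod>j\<in>B. fact (l j) :: nat) dvd (\<Prod>j\<in>A. fact (l j))"
proof (rule multiplicity_le_imp_dvd)
  show "(\<Prod>j\<in>B. fact (l j) :: nat) \<noteq> 0" using assms by simp
  fix p :: nat assume p: "prime p"
  \<comment> \<open>A common bound for all \<open>l j\<close>, so that both products are expanded
    over the same range of \<open>k\<close>.\<close>
  define K where "K = (\<Sum>j\<in>A \<union> B. l j)"
  have mult: "multiplicity p (\<Prod>j\<in>C. fact (l j)) = (\<Sum>k=1..K. \<Sum>j\<in>C. l j div p ^ k)"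
    if "C \<subseteq> A \<union> B" for C
  proof -
    have C: "finite C" using that assms finite_subset by blast
    have "multiplicity p (\<Prod>j\<in>C. fact (l j)) = (\<Sum>j\<in>C. multiplicity p (fact (l j)))"
      using p C by (intro prime_elem_multiplicity_prod_distrib) auto
    also have "\<dots> = (\<Sum>j\<in>C. \<Sum>k=1..K. l j div p ^ k)"
    proof (intro sum.cong refl legendre_multiplicity_fact p)
      fix j assume "j \<in> C"
      then show "l j \<le> K"
        unfolding K_def using that assms by (intro member_le_sum) auto
    qed
    also have "\<dots> = (\<Sum>k=1..K. \<Sum>j\<in>C. l j div p ^ k)" by (rule sum.swap)
    finally show ?thesis .
  qed
  show "multiplicity p (\<Prod>j\<in>B. fact (l j)) \<le> multiplicity p (\<Prod>j\<in>A. fact (l j))"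
    unfolding mult[OF Un_upper1] mult[OF Un_upper2]
    using p by (intro sum_mono le) (simp add: prime_gt_0_nat)
qed

section \<open>Faces and relative interiors of convex cones\<close>

text \<open>A face of a cone is conic, so it contains the midpoint of \<open>x\<close> and
  \<open>y\<close>; unless \<open>x = y\<close>, this point is inside the open segment, and the face
  property yields \<open>x\<close>.\<close>

lemma face_of_convex_cone_summand:
  assumes K: "convex_cone K" and T: "T face_of K"
    and "x \<in> K" "y \<in> K" and xy: "x + y \<in> T"
  shows "x \<in> T"
proof -
  have "conic T" using K T face_of_conic by (auto simp: convex_cone_def)
  then have half: "(1/2) *\<^sub>R (x + y) \<in> T" using xy by (simp add: conic_def)
  show ?thesis
  proof (cases "x = y")
    case True
    have "(1/2) *\<^sub>R (y + y) = y" by (metis scaleR_half_double)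
    then show ?thesis using half True by simp
  next
    case False
    have "(1/2) *\<^sub>R (x + y) = midpoint x y" by (simp add: midpoint_def)
    then have "(1/2) *\<^sub>R (x + y) \<in> open_segment x y" using False by simp
    then show ?thesis using T half assms(3,4) unfolding face_of_def by blast
  qed
qed

text \<open>Scaling by \<open>c > 0\<close> maps \<open>S\<close> onto itself and commutes with
  taking the relative interior.\<close>

lemma rel_interior_convex_cone_scaleR:
  fixes S :: "'a::euclidean_space set"
  assumes S: "convex_cone S" and c: "0 < c" and x: "x \<in> rel_interior S"
  shows "c *\<^sub>R x \<in> rel_interior S"
proof -
  have "(*\<^sub>R) c ` S = S"
  proof
    show "(*\<^sub>R) c ` S \<subseteq> S" using S c by (auto intro: convex_cone_scaleR)
    show "S \<subseteq> (*\<^sub>R) c ` S"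
    proof
      fix y assume "y \<in> S"
      then have "(1/c) *\<^sub>R y \<in> S" using S c by (intro convex_cone_scaleR) auto
      moreover have "y = c *\<^sub>R ((1/c) *\<^sub>R y)" using c by simp
      ultimately show "y \<in> (*\<^sub>R) c ` S" by blast
    qed
  qed
  then show ?thesis using rel_interior_scaleR[of c S] c x by auto
qed

lemma rel_interior_convex_cone_add:
  fixes S :: "'a::euclidean_space set"
  assumes S: "convex_cone S" and x: "x \<in> rel_interior S" and y: "y \<in> S"
  shows "x + y \<in> rel_interior S"
proof -
  \<comment> \<open>The midpoint of \<open>x\<close> and \<open>y\<close>, written as
    \<open>y\<close> shrunk towards the relative interior point \<open>x\<close>; doubling it gives
    \<open>x + y\<close>.\<close>
  have "y - (1/2) *\<^sub>R (y - x) \<in> rel_interior S"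
    using S x y by (intro rel_interior_convex_shrink) (auto simp: convex_cone_def)
  then have "2 *\<^sub>R (y - (1/2) *\<^sub>R (y - x)) \<in> rel_interior S"
    by (intro rel_interior_convex_cone_scaleR S) auto
  moreover have "2 *\<^sub>R (y - (1/2) *\<^sub>R (y - x)) = x + y"
    by (simp add: algebra_simps scaleR_2)
  ultimately show ?thesis by simp
qed

lemma convex_cone_sum:
  assumes S: "convex_cone S" and "\<And>j. j \<in> I \<Longrightarrow> f j \<in> S"
  shows "(\<Sum>j\<in>I. f j) \<in> S"
  using assms(2)
  by (induction I rule: infinite_finite_induct)
    (auto intro: convex_cone_contains_0 convex_cone_add S)

lemma real_vec_add: "real_vec (x + y) = real_vec x + real_vec y"
  and real_vec_scale: "real_vec (c *s x) = real_of_int c *\<^sub>R real_vec x"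
  by (simp_all add: real_vec_def vec_eq_iff)

lemma real_vec_sum: "real_vec (\<Sum>j\<in>I. f j) = (\<Sum>j\<in>I. real_vec (f j))"
  by (simp add: real_vec_def vec_eq_iff)

section \<open>The face of \<open>beta\<close> and the index sets of the series\<close>

text \<open>The face contains \<open>beta\<close>, a sum of generators of the cone, hence it
  contains each summand.\<close>

lemma face_sigma_beta:
  fixes a :: "nat \<Rightarrow> int ^ 'n"
  assumes MN: "M \<le> N" and a1: "\<And>j. j \<in> {1..N} \<Longrightarrow> a j $ n = 1"
  shows convex_cone_face_sigma_beta: "convex_cone (face_sigma a N (beta a M))"
    and generator_in_face_sigma_beta: "\<And>j. j \<in> {1..M} \<Longrightarrow> real_vec (a j) \<in> face_sigma a N (beta a M)"
proof -
  let ?S = "face_sigma a N (beta a M)"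
  have K: "convex_cone (coneA a N)" by (simp add: coneA_def convex_cone_convex_cone_hull)
  have gen: "real_vec (a j) \<in> coneA a N" if "j \<in> {1..M}" for j
    unfolding coneA_def using that MN by (intro hull_inc) auto
  have b: "real_vec (beta a M) \<in> coneA a N"
    unfolding beta_def real_vec_sum by (intro convex_cone_sum K gen)
  have S: "?S face_of coneA a N" "real_vec (beta a M) \<in> ?S"
    using face_sigma_least[OF a1 b] by auto
  show "convex_cone ?S"
    using S K face_of_conic face_of_imp_convex unfolding convex_cone_def by blast
  fix j assume j: "j \<in> {1..M}"
  have "real_vec (beta a M) = real_vec (a j) + (\<Sum>i\<in>{1..M}-{j}. real_vec (a i))"
    unfolding beta_def real_vec_sum using j by (subst sum.remove[of _ j]) auto
  with S(2) have "real_vec (a j) + (\<Sum>i\<in>{1..M}-{j}. real_vec (a i)) \<in> ?S" by simp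
  moreover have "(\<Sum>i\<in>{1..M}-{j}. real_vec (a i)) \<in> coneA a N"
    by (intro convex_cone_sum K gen) simp
  ultimately show "real_vec (a j) \<in> ?S"
    using face_of_convex_cone_summand[OF K S(1)] gen[OF j] by blast
qed

text \<open>The function \<open>f\<close> is left general to cover both the vector sum defining
  \<open>u\<close> and the sum of the exponents alone, which is the degree.\<close>

lemma sum_F_exponent_split:
  assumes "M \<le> N"
  shows "(\<Sum>j=1..N. f (F_exponent M l j) j)
    = (\<Sum>j=1..M. f (- int (l j) - 1) j) + (\<Sum>j=M+1..N. f (int (l j)) j)"
proof -
  have "{1..N} = {1..M} \<union> {M+1..N}" using assms by auto
  then have "(\<Sum>j=1..N. f (F_exponent M l j) j)
    = (\<Sum>j=1..M. f (F_exponent M l j) j) + (\<Sum>j=M+1..N. f (F_exponent M l j) j)"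
    by (simp add: sum.union_disjoint)
  then show ?thesis by (simp add: F_exponent_def)
qed

lemma F_index_iff:
  assumes "M \<le> N"
  shows "l \<in> F_index a M N u \<longleftrightarrow> l \<in> E_beta a M N \<and> u = (\<Sum>j=1..N. F_exponent M l j *s a j)"
  unfolding F_index_def sum_F_exponent_split[OF assms, of "\<lambda>c j. c *s a j"] by auto

lemma F_term_nonzero: "F_term M N l \<noteq> 0"
  by (simp add: F_term_def)

lemma M_beta_F_exponent_div:
  fixes a :: "nat \<Rightarrow> int ^ 'n"
  assumes MN: "M \<le> N" and a1: "\<And>j. j \<in> {1..N} \<Longrightarrow> a j $ n = 1"
    and u: "u \<in> M_beta a M N" and l: "l \<in> F_index a M N u" and q: "0 < q"
  shows "(\<Sum>j=1..N. F_exponent M (\<lambda>j. l j div q) j *s a j) \<in> M_beta a M N"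
proof -
  let ?S = "face_sigma a N (beta a M)"
  define m where "m = (\<lambda>j. l j div q)"
  define w where "w = (\<Sum>j=1..N. F_exponent M m j *s a j)"
  \<comment> \<open>Both branches are nonnegative, so \<open>v\<close> is a nonnegative combination
    of the generators.\<close>
  define r where "r j = (if j \<in> {1..M} then q - 1 - l j mod q else l j mod q)" for j
  define v where "v = (\<Sum>j=1..N. int (r j) *s a j)"
  have S: "convex_cone ?S" by (rule convex_cone_face_sigma_beta[OF MN a1])
  have lE: "l \<in> E_beta a M N" and u_eq: "u = (\<Sum>j=1..N. F_exponent M l j *s a j)"
    using l F_index_iff[OF MN] by blast+
  have "F_exponent M l j = int q * F_exponent M m j + int (r j)" for j
  proof -
    have "int (l j) = int q * int (l j div q) + int (l j mod q)"
      by (metis mult_div_mod_eq of_nat_add of_nat_mult)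
    moreover have "int (q - 1 - l j mod q) = int q - 1 - int (l j mod q)"
      using q mod_less_divisor[OF q, of "l j"] by linarith
    ultimately show ?thesis by (auto simp: F_exponent_def m_def r_def algebra_simps)
  qed
  then have u_w: "u = int q *s w + v"
    unfolding u_eq w_def v_def
    by (simp add: vec_eq_iff sum.distrib sum_distrib_left distrib_right mult.assoc)
  have "real_vec v \<in> ?S"
    unfolding v_def real_vec_sum
  proof (intro convex_cone_sum S)
    fix j assume j: "j \<in> {1..N}"
    show "real_vec (int (r j) *s a j) \<in> ?S"
    proof (cases "real_vec (a j) \<in> ?S")
      case True
      then show ?thesis using S by (simp add: real_vec_scale convex_cone_scaleR)
    next
      case False
      \<comment> \<open>Knowing \<open>l j = 0\<close> is not enough: for \<open>j\<close> in
        \<open>{1..M}\<close> the remainder would be \<open>q - 1\<close>. That case is excluded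
        since those generators lie in the face.\<close>
      then have "l j = 0" "j \<notin> {1..M}"
        using lE j generator_in_face_sigma_beta[OF MN, of a, OF a1] by (auto simp: E_beta_def)
      then have "r j = 0" by (auto simp: r_def)
      then show ?thesis using convex_cone_contains_0[OF S] by (simp add: real_vec_def zero_vec_def)
    qed
  qed
  then have "- real_vec u + real_vec v \<in> rel_interior ?S"
    using u by (intro rel_interior_convex_cone_add S) (auto simp: M_beta_def face_sigma_int_def)
  then have "(1 / real q) *\<^sub>R (- real_vec u + real_vec v) \<in> rel_interior ?S"
    using q by (intro rel_interior_convex_cone_scaleR S) auto
  moreover have "(1 / real q) *\<^sub>R (- real_vec u + real_vec v) = - real_vec w"
    using q by (simp add: u_w real_vec_add real_vec_scale)
  ultimately have "- real_vec w \<in> face_sigma_int a N (beta a M)"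
    by (simp add: face_sigma_int_def)
  moreover have "w \<in> latticeA a N"
    unfolding latticeA_def w_def by blast
  ultimately show ?thesis by (simp add: M_beta_def w_def m_def)
qed

theorem theorem2p10:
  fixes a :: "nat \<Rightarrow> int ^ 'n" and M N :: nat and n :: 'n
  assumes "1 \<le> M" and "M \<le> N"
    and "\<And>j. j \<in> {1..N} \<Longrightarrow> a j $ n = 1"
    and "minimal_for_sigma a M N"
    and "int M \<in> {- (u $ n) |u. u \<in> M_beta a M N \<and> F_series a M N u \<noteq> (\<lambda>e. 0)}"
    and "\<forall>m \<in> {- (u $ n) |u. u \<in> M_beta a M N \<and> F_series a M N u \<noteq> (\<lambda>e. 0)}. int M \<le> m"
  shows "\<forall>u \<in> M_beta a M N. integral_coeffs (F_series a M N u)"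
proof
  fix u assume u: "u \<in> M_beta a M N"
  have term_int: "F_term M N l \<in> \<int>" if l: "l \<in> F_index a M N u" for l
  proof -
    have "(\<Sum>j=M+1..N. l j div q) \<le> (\<Sum>j=1..M. l j div q)" if q: "0 < q" for q
    proof -
      define m where "m = (\<lambda>j. l j div q)"
      define w where "w = (\<Sum>j=1..N. F_exponent M m j *s a j)"
      have w: "w \<in> M_beta a M N"
        unfolding w_def m_def by (rule M_beta_F_exponent_div[OF assms(2,3) u l q])
      have "m \<in> E_beta a M N" using l by (auto simp: F_index_def E_beta_def m_def)
      then have "m \<in> F_index a M N w" using F_index_iff[OF assms(2)] w_def by blast
      \<comment> \<open>No cancellation can occur, because only \<open>m\<close> contributes to this
        exponent.\<close>
      then have "F_series a M N w (F_exponent M m) \<noteq> 0"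
        using F_series_exponent F_term_nonzero by metis
      then have "F_series a M N w \<noteq> (\<lambda>e. 0)" by (metis (no_types))
      with w have "int M \<le> - (w $ n)" using assms(6) by blast
      \<comment> \<open>All last coordinates are 1, so \<open>w $ n\<close> is the total degree. Its
        \<open>M\<close> summands \<open>- 1\<close> then cancel the bound
        \<open>int M\<close>.\<close>
      also have "w $ n = (\<Sum>j=1..N. F_exponent M m j)"
        using assms(3) by (simp add: w_def)
      also have "\<dots> = (\<Sum>j=1..M. - int (m j) - 1) + (\<Sum>j=M+1..N. int (m j))"
        by (rule sum_F_exponent_split[OF assms(2)])
      finally have "(\<Sum>j=M+1..N. int (m j)) \<le> (\<Sum>j=1..M. int (m j))"
        by (simp add: sum_subtractf sum_negf)
      then have "int (\<Sum>j=M+1..N. m j) \<le> int (\<Sum>j=1..M. m j)" by simp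
      then show ?thesis unfolding m_def by linarith
    qed
    then have "(\<Prod>j=M+1..N. fact (l j) :: nat) dvd (\<Prod>j=1..M. fact (l j))"
      by (intro prod_fact_dvd_prod_fact) auto
    then obtain k where "(\<Prod>j=1..M. fact (l j) :: nat) = (\<Prod>j=M+1..N. fact (l j)) * k"
      by (elim dvdE)
    then have "of_nat (\<Prod>j=1..M. fact (l j)) = (of_nat ((\<Prod>j=M+1..N. fact (l j)) * k) :: rat)"
      by (rule arg_cong)
    then have "(\<Prod>j=1..M. fact (l j) :: rat) = (\<Prod>j=M+1..N. fact (l j)) * of_nat k"
      by simp
    then have "F_term M N l = (-1) ^ (\<Sum>j=1..M. l j) * of_nat k"
      by (simp add: F_term_def)
    then show ?thesis by simp
  qed
  show "integral_coeffs (F_series a M N u)"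
    unfolding integral_coeffs_def F_series_def by (auto intro!: Ints_sum term_int)
qed

end
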